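(* Let $n\ge 2$ and $\delta\in\{\mathrm I,\mathrm D\}^n$ with $\delta_1=\delta_n=\mathrm I$. The set of integer $\mathbf d$-flows of the $\delta$-bicho graph $\mathrm{Bic}_\delta$, where $\mathbf d=(0,1,\dots,1,-(n-1))$ on the vertices $(v_0,v_1,\dots,v_{n-1},v_n)$, is in bijection with the set of $\delta$-permutrees on $n$ nodes.
   Context: Decorations $\mathrm I$ (one parent, one child) and $\mathrm D$ (one parent, two children), and also $\mathrm U$ (two parents, one child), $\mathrm X$ (two parents, two children). A $\delta$-permutree is a directed tree on nodes $v_1,\dots,v_n$ (dangling leaf/root edges allowed, so a slot may be empty) where $v_i$ has two parent slots if $\delta_i\in\{\mathrm U,\mathrm X\}$ (one otherwise) and two child slots if $\delta_i\in\{\mathrm D,\mathrm X\}$ (one otherwise); removing $v_i$, each slot gives a (possibly empty) subtree, and with two children (resp. parents) the left descendant (resp. ancestor) subtree has labels $<i$ and the right one labels $>i$. The oruga graph $\mathcal O_n$ has vertices $v_0,\dots,v_n$ and, for each $i\in[n]$, two parallel edges from $v_{n-i}$ to $v_{n+1-i}$: the bump $e^i_0$ and the dip $e^i_1$. An M-move on an edge $(v_a,v_{a+1})$ removes it and adds the edges $(v_0,v_{a+1})$ and $(v_a,v_n)$. For $\delta\in\{\mathrm I,\mathrm D,\mathrm U,\mathrm X\}^n$ with $\delta_1=\delta_n=\mathrm I$, $\mathrm{Bic}_\delta$ is obtained from $\mathcal O_n$ by performing the M-move on $e^i_0$ for each $i$ with $\delta_i\in\{\mathrm U,\mathrm X\}$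 and on $e^i_1$ for each $i$ with $\delta_i\in\{\mathrm D,\mathrm X\}$. An integer $\mathbf d$-flow is $f:E\to\mathbb Z_{\ge0}$ with (outflow) $-$ (inflow) $=\mathbf d_v$ at every vertex $v$. *)

theory Defs
  imports "Graph_Theory.Digraph_Component"
begin

datatype decoration = Dec_I | Dec_D | Dec_U | Dec_X


text \<open>Bicho graphs. The vertex \<open>v\<^sub>j\<close> is the natural number \<open>j\<close>. Since parallel edges must be kept
  apart, edges are names: \<open>Bump i\<close> and \<open>Dip i\<close> are the edges \<open>e\<^sup>i\<^sub>0\<close> and \<open>e\<^sup>i\<^sub>1\<close> of the oruga graph,
  and \<open>From_source e\<close>, \<open>To_sink e\<close> are the two edges that an M-move on \<open>e\<close> creates.\<close>

datatype arc_name = Bump nat | Dip nat | From_source arc_name | To_sink arc_name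

primrec arc_index :: "arc_name \<Rightarrow> nat" where
  "arc_index (Bump i) = i"
| "arc_index (Dip i) = i"
| "arc_index (From_source e) = arc_index e"
| "arc_index (To_sink e) = arc_index e"

text \<open>Only the values of \<open>tail\<close> and \<open>head\<close> on the arcs matter; those on the names of edges that are
  not yet present are overwritten by the M-move that creates them.\<close>

definition oruga :: "nat \<Rightarrow> (nat, arc_name) pre_digraph" where
  "oruga n = \<lparr> verts = {0..n}, arcs = Bump ` {1..n} \<union> Dip ` {1..n},
     tail = (\<lambda>e. n - arc_index e), head = (\<lambda>e. n + 1 - arc_index e) \<rparr>"

definition M_move :: "nat \<Rightarrow> arc_name \<Rightarrow> (nat, arc_name) pre_digraph \<Rightarrow> (nat, arc_name) pre_digraph" where
  "M_move n e G = \<lparr> verts = verts G, arcs = (arcs G - {e}) \<union> {From_source e, To_sink e},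
     tail = (tail G)(From_source e := 0, To_sink e := tail G e),
     head = (head G)(From_source e := head G e, To_sink e := n) \<rparr>"

definition Bic :: "nat \<Rightarrow> (nat \<Rightarrow> decoration) \<Rightarrow> (nat, arc_name) pre_digraph" where
  "Bic n \<delta> = fold (M_move n)
     (map Bump (filter (\<lambda>i. \<delta> i \<in> {Dec_U, Dec_X}) [1..<Suc n]) @
      map Dip (filter (\<lambda>i. \<delta> i \<in> {Dec_D, Dec_X}) [1..<Suc n]))
     (oruga n)"

text \<open>Functions in \<open>\<rightarrow>\<^sub>E\<close> are fixed outside the arcs, so that a flow is determined by its values on
  the arcs.\<close>

definition integer_flows :: "('v, 'e) pre_digraph \<Rightarrow> ('v \<Rightarrow> int) \<Rightarrow> ('e \<Rightarrow> int) set" where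
  "integer_flows G d = {f \<in> arcs G \<rightarrow>\<^sub>E {0..}.
     \<forall>v\<in>verts G. (\<Sum>e\<in>out_arcs G v. f e) - (\<Sum>e\<in>in_arcs G v. f e) = d v}"

definition netflow :: "nat \<Rightarrow> nat \<Rightarrow> int" where
  "netflow n v = (if v = 0 then 0 else if v = n then - (int n - 1) else 1)"


text \<open>Permutrees. The node \<open>v\<^sub>i\<close> is its label \<open>i\<close>. A permutree is given by the set of its edges
  between nodes; an edge records its child end and its parent end, and which parent slot of the
  former and which child slot of the latter it occupies. A slot occupied by no edge carries a
  dangling edge, i.e. an empty subtree.\<close>

datatype slot = Only | Left | Right

datatype tree_edge =
  Tree_Edge (child: nat) (parent_slot: slot) (parent: nat) (child_slot: slot)

definition parent_slots :: "decoration \<Rightarrow> slot set" where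
  "parent_slots c = (if c \<in> {Dec_U, Dec_X} then {Left, Right} else {Only})"

definition child_slots :: "decoration \<Rightarrow> slot set" where
  "child_slots c = (if c \<in> {Dec_D, Dec_X} then {Left, Right} else {Only})"

definition tree_graph :: "nat \<Rightarrow> tree_edge set \<Rightarrow> (nat, tree_edge) pre_digraph" where
  "tree_graph n T = \<lparr> verts = {1..n}, arcs = T, tail = child, head = parent \<rparr>"

text \<open>A cycle \<open>x\<^sub>0, e\<^sub>0, x\<^sub>1, \<dots>, e\<^sub>k\<^sub>-\<^sub>1, x\<^sub>0\<close> of the underlying undirected multigraph. The constant \<open>tree\<close>
  of the library is not suitable here, as it excludes directed cycles only.\<close>

definition undirected_cycle :: "('v, 'e) pre_digraph \<Rightarrow> 'v list \<Rightarrow> 'e list \<Rightarrow> bool" where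
  "undirected_cycle G xs es \<longleftrightarrow>
     xs \<noteq> [] \<and> length es = length xs \<and> distinct xs \<and> distinct es \<and>
     set xs \<subseteq> verts G \<and> set es \<subseteq> arcs G \<and>
     (\<forall>j<length xs. {tail G (es ! j), head G (es ! j)} = {xs ! j, xs ! (Suc j mod length xs)})"

definition directed_tree :: "('v, 'e) pre_digraph \<Rightarrow> bool" where
  "directed_tree G \<longleftrightarrow> wf_digraph G \<and> connected G \<and> (\<nexists>xs es. undirected_cycle G xs es)"

text \<open>The nodes of the connected component of \<open>u\<close> after removal of \<open>v\<close>.\<close>

definition branch :: "('v, 'e) pre_digraph \<Rightarrow> 'v \<Rightarrow> 'v \<Rightarrow> 'v set" where
  "branch G v u = {w. u \<rightarrow>\<^sup>*\<^bsub>mk_symmetric (pre_digraph.del_vert G v)\<^esub> w}"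

definition descendant_subtree :: "nat \<Rightarrow> tree_edge set \<Rightarrow> nat \<Rightarrow> slot \<Rightarrow> nat set" where
  "descendant_subtree n T i s =
     (\<Union>e\<in>{e \<in> T. parent e = i \<and> child_slot e = s}. branch (tree_graph n T) i (child e))"

definition ancestor_subtree :: "nat \<Rightarrow> tree_edge set \<Rightarrow> nat \<Rightarrow> slot \<Rightarrow> nat set" where
  "ancestor_subtree n T i s =
     (\<Union>e\<in>{e \<in> T. child e = i \<and> parent_slot e = s}. branch (tree_graph n T) i (parent e))"

definition permutrees :: "nat \<Rightarrow> (nat \<Rightarrow> decoration) \<Rightarrow> tree_edge set set" where
  "permutrees n \<delta> = {T.
     directed_tree (tree_graph n T) \<and>
     (\<forall>e\<in>T. parent_slot e \<in> parent_slots (\<delta> (child e)) \<and> child_slot e \<in> child_slots (\<delta> (parent e))) \<and>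
     inj_on (\<lambda>e. (child e, parent_slot e)) T \<and>
     inj_on (\<lambda>e. (parent e, child_slot e)) T \<and>
     (\<forall>i\<in>{1..n}. \<delta> i \<in> {Dec_D, Dec_X} \<longrightarrow>
        (\<forall>j\<in>descendant_subtree n T i Left. j < i) \<and> (\<forall>j\<in>descendant_subtree n T i Right. i < j)) \<and>
     (\<forall>i\<in>{1..n}. \<delta> i \<in> {Dec_U, Dec_X} \<longrightarrow>
        (\<forall>j\<in>ancestor_subtree n T i Left. j < i) \<and> (\<forall>j\<in>ancestor_subtree n T i Right. i < j))}"

end

theory Submission
  imports Defs "HOL-Library.Tree"
begin

text \<open>
  A permutree with decorations in \<open>{I, D}\<close> is a rooted tree, encoded below as a binary tree in which
  the only child of an \<open>I\<close>-node sits on the left. It is built by inserting the labels \<open>n, \<dots>, 1\<close> in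
  this order: since the new label \<open>i\<close> is smaller than all previous ones, it must be placed on the left
  spine, so if the spine has \<open>s\<close> nodes, the insertion depth is any \<open>k \<le> s\<close>. The subtree below
  becomes the only child of \<open>i\<close> if \<open>i\<close> is an \<open>I\<close>-node and the right child if \<open>i\<close> is a \<open>D\<close>-node, so the
  new spine has \<open>s + 1\<close> nodes in the first case and \<open>k + 1\<close> in the second.

  In a flow, nothing leaves the source, and \<open>v\<^bsub>n-i\<^esub>\<close> sends a total of \<open>s\<close> units along the bump \<open>e\<^sup>i\<^sub>0\<close> and
  its second outgoing edge. If \<open>k\<close> of them use the bump, then the next vertex has to send \<open>s + 1\<close>
  units if \<open>i\<close> is an \<open>I\<close>-node, and \<open>k + 1\<close> units if the other \<open>s - k\<close> have gone to the sink. So both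
  sides are encoded by the same sequences of numbers \<open>k\<close>.
\<close>

section \<open>Building decorated trees by insertion\<close>

text \<open>The condition \<open>v \<notin> set_tree l\<close> makes labels distinct at I-nodes,
  where no order separates \<open>v\<close> from its subtree. Fixing \<open>r = Leaf\<close> there
  leaves one code per permutree.\<close>

primrec decorated :: "(nat \<Rightarrow> decoration) \<Rightarrow> nat tree \<Rightarrow> bool" where
  "decorated \<delta> Leaf \<longleftrightarrow> True"
| "decorated \<delta> (Node l v r) \<longleftrightarrow> decorated \<delta> l \<and> decorated \<delta> r \<and> v \<notin> set_tree l \<and>
     (if \<delta> v = Dec_D then (\<forall>j\<in>set_tree l. j < v) \<and> (\<forall>j\<in>set_tree r. v < j) else r = Leaf)"

primrec spine :: "'a tree \<Rightarrow> nat" where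
  "spine Leaf = 0"
| "spine (Node l v r) = Suc (spine l)"

text \<open>The counter \<open>k\<close> walks down the left spine. The clause for
  \<open>Suc k\<close> and \<open>Leaf\<close> is a default that is not reached while
  \<open>k \<le> spine t\<close>.\<close>

fun ins :: "(nat \<Rightarrow> decoration) \<Rightarrow> nat \<Rightarrow> nat \<Rightarrow> nat tree \<Rightarrow> nat tree" where
  "ins \<delta> x 0 t = (if \<delta> x = Dec_D then Node Leaf x t else Node t x Leaf)"
| "ins \<delta> x (Suc k) Leaf = Leaf"
| "ins \<delta> x (Suc k) (Node l v r) = Node (ins \<delta> x k l) v r"

lemma set_tree_ins: "k \<le> spine t \<Longrightarrow> set_tree (ins \<delta> x k t) = insert x (set_tree t)"
  by (induction \<delta> x k t rule: ins.induct) auto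

lemma spine_ins:
  "k \<le> spine t \<Longrightarrow> spine (ins \<delta> x k t) = (if \<delta> x = Dec_D then Suc k else Suc (spine t))"
  by (induction \<delta> x k t rule: ins.induct) auto

lemma decorated_ins:
  assumes "decorated \<delta> t" "\<forall>j\<in>set_tree t. x < j" "k \<le> spine t"
  shows "decorated \<delta> (ins \<delta> x k t)"
  using assms by (induction \<delta> x k t rule: ins.induct) (auto simp: set_tree_ins)

text \<open>As \<open>x\<close> occurs nowhere else, its depth on the left spine of the result
  recovers \<open>k\<close>, and taking it out recovers \<open>t\<close>.\<close>

lemma ins_inject:
  assumes "ins \<delta> x k t = ins \<delta> x k' t'" "k \<le> spine t" "k' \<le> spine t'"
    and "x \<notin> set_tree t" "x \<notin> set_tree t'"
  shows "k = k' \<and> t = t'"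
  using assms
proof (induction k arbitrary: t k' t')
  case 0
  then show ?case by (cases k'; cases t') (auto split: if_splits)
next
  case (Suc k)
  then obtain l v r where t: "t = Node l v r" by (cases t) auto
  show ?case
  proof (cases k')
    case 0
    then show ?thesis using Suc.prems t by (auto split: if_splits)
  next
    case (Suc m)
    then obtain l' v' r' where t': "t' = Node l' v' r'" using Suc.prems by (cases t') auto
    show ?thesis using Suc.IH[of l m l'] Suc.prems t t' Suc by auto
  qed
qed

text \<open>The minimal label lies on the left spine: an I-node has no right subtree, and labels to
  the right of a D-node exceed that node's label. It has at most one nonempty subtree, which can
  take its place.\<close>

lemma ins_surj:
  assumes "decorated \<delta> t" "set_tree t = insert x S" "\<forall>j\<in>S. x < j"
  shows "\<exists>k u. t = ins \<delta> x k u \<and> k \<le> spine u \<and> decorated \<delta> u \<and> set_tree u = S"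
  using assms
proof (induction t arbitrary: S)
  case (Node l v r)
  show ?case
  proof (cases "v = x")
    case True
    show ?thesis
    proof (cases "\<delta> x = Dec_D")
      case D: True
      \<comment> \<open>A label to the left of the D-node \<open>x\<close> would lie below the
        minimum.\<close>
      have "set_tree l \<subseteq> {}"
      proof
        fix j assume j: "j \<in> set_tree l"
        then have "j < x" using Node.prems(1) True D by auto
        moreover have "j \<in> insert x S" using j Node.prems(2) by auto
        ultimately show "j \<in> {}" using Node.prems(3) by auto
      qed
      then have l: "l = Leaf" by simp
      have "set_tree r = S" using Node.prems True D l by auto
      then have "Node l v r = ins \<delta> x 0 r \<and> 0 \<le> spine r \<and> decorated \<delta> r \<and> set_tree r = S"
        using Node.prems True D l by auto
      then show ?thesis by blast
    next
      case False
      then have r: "r = Leaf" and "x \<notin> set_tree l" using Node.prems True by auto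
      moreover have "set_tree l = S" using Node.prems True r \<open>x \<notin> set_tree l\<close> by auto
      ultimately have "Node l v r = ins \<delta> x 0 l \<and> 0 \<le> spine l \<and> decorated \<delta> l \<and> set_tree l = S"
        using Node.prems True False by auto
      then show ?thesis by blast
    qed
  next
    case False
    then have "v \<in> S" using Node.prems(2) by auto
    then have "x < v" using Node.prems(3) by auto
    have "x \<in> set_tree l \<union> set_tree r" using Node.prems(2) False by auto
    moreover have "x \<notin> set_tree r" using Node.prems(1) \<open>x < v\<close> by (auto split: if_splits)
    ultimately have xl: "x \<in> set_tree l" by simp
    have "\<forall>j\<in>set_tree l - {x}. x < j" using Node.prems(2,3) by auto
    moreover have "set_tree l = insert x (set_tree l - {x})" using xl by auto
    moreover have "decorated \<delta> l" using Node.prems(1) by simp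
    ultimately obtain k u where u: "l = ins \<delta> x k u" "k \<le> spine u" "decorated \<delta> u"
      "set_tree u = set_tree l - {x}" using Node.IH(1) by blast
    have "decorated \<delta> (Node u v r)" using Node.prems(1) u by (auto split: if_splits)
    moreover have "set_tree (Node u v r) = S"
    proof -
      have "x \<notin> S" using Node.prems(3) by auto
      have "insert x S = set_tree l \<union> {v} \<union> set_tree r" using Node.prems(2) by auto
      then show ?thesis using \<open>x \<notin> S\<close> u(4) \<open>x \<notin> set_tree r\<close> False by auto
    qed
    moreover have "Node l v r = ins \<delta> x (Suc k) (Node u v r)" using u by simp
    moreover have "Suc k \<le> spine (Node u v r)" using u by simp
    ultimately show ?thesis by blast
  qed
qed simp

text \<open>The last list entry is the insertion depth of \<open>n\<close>, and the head that of the smallest label.\<close>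

primrec build :: "(nat \<Rightarrow> decoration) \<Rightarrow> nat \<Rightarrow> nat list \<Rightarrow> nat tree" where
  "build \<delta> n [] = Leaf"
| "build \<delta> n (k # ks) = ins \<delta> (n - length ks) k (build \<delta> n ks)"

primrec admissible :: "(nat \<Rightarrow> decoration) \<Rightarrow> nat \<Rightarrow> nat list \<Rightarrow> bool" where
  "admissible \<delta> n [] \<longleftrightarrow> True"
| "admissible \<delta> n (k # ks) \<longleftrightarrow> admissible \<delta> n ks \<and> k \<le> spine (build \<delta> n ks)"

lemma greaterThanAtMost_insert_diff:
  "m < n \<Longrightarrow> {n - Suc m<..n} = insert (n - m) {n - m<..n}" for m n :: nat
  by auto

lemma set_tree_build:
  "admissible \<delta> n ks \<Longrightarrow> length ks \<le> n \<Longrightarrow> set_tree (build \<delta> n ks) = {n - length ks<..n}"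
  by (induction ks) (simp_all add: set_tree_ins greaterThanAtMost_insert_diff)

lemma decorated_build: "admissible \<delta> n ks \<Longrightarrow> length ks \<le> n \<Longrightarrow> decorated \<delta> (build \<delta> n ks)"
  by (induction ks) (simp_all add: set_tree_build decorated_ins)

lemma build_inject:
  assumes "length ks = length ks'" "length ks \<le> n" "admissible \<delta> n ks" "admissible \<delta> n ks'"
    and "build \<delta> n ks = build \<delta> n ks'"
  shows "ks = ks'"
  using assms
proof (induction ks ks' rule: list_induct2)
  case (Cons k ks k' ks')
  have "k = k' \<and> build \<delta> n ks = build \<delta> n ks'"
    by (rule ins_inject) (use Cons.prems Cons.hyps in \<open>auto simp: set_tree_build\<close>)
  then show ?case using Cons by auto
qed simp

text \<open>The smallest label was inserted last, so the insertions are undone in increasing order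
  of labels.\<close>

lemma build_surj:
  assumes "m \<le> n" "decorated \<delta> t" "set_tree t = {n - m<..n}"
  shows "\<exists>ks. length ks = m \<and> admissible \<delta> n ks \<and> build \<delta> n ks = t"
  using assms
proof (induction m arbitrary: t)
  case (Suc m)
  have "set_tree t = insert (n - m) {n - m<..n}"
    using Suc.prems(1,3) by (simp add: greaterThanAtMost_insert_diff)
  from ins_surj[OF Suc.prems(2) this]
  obtain k u where u: "t = ins \<delta> (n - m) k u" "k \<le> spine u" "decorated \<delta> u"
    "set_tree u = {n - m<..n}"
    by auto
  then obtain ks where "length ks = m" "admissible \<delta> n ks" "build \<delta> n ks = u"
    using Suc.IH[of u] Suc.prems(1) by auto
  then have "length (k # ks) = Suc m \<and> admissible \<delta> n (k # ks) \<and> build \<delta> n (k # ks) = t"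
    using u by simp
  then show ?case by blast
qed simp

lemma bij_betw_build:
  "bij_betw (build \<delta> n) {ks. length ks = n \<and> admissible \<delta> n ks}
     {t. decorated \<delta> t \<and> set_tree t = {1..n}}"
proof -
  have n: "{n - n<..n} = {1..n}" by auto
  show ?thesis
  proof (rule bij_betw_imageI)
    show "inj_on (build \<delta> n) {ks. length ks = n \<and> admissible \<delta> n ks}"
      by (rule inj_onI) (auto intro: build_inject)
    show "build \<delta> n ` {ks. length ks = n \<and> admissible \<delta> n ks} =
        {t. decorated \<delta> t \<and> set_tree t = {1..n}}" (is "?L = ?R")
    proof
      show "?L \<subseteq> ?R"
      proof (clarify, intro conjI)
        fix ks assume "admissible \<delta> (length ks) ks"
        then show "decorated \<delta> (build \<delta> (length ks) ks)"
          "set_tree (build \<delta> (length ks) ks) = {1..length ks}"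
          by (auto simp: decorated_build set_tree_build)
      qed
      show "?R \<subseteq> ?L"
      proof
        fix t assume "t \<in> ?R"
        then show "t \<in> ?L" using build_surj[of n n \<delta> t] n by auto
      qed
    qed
  qed
qed

section \<open>Decorated trees as permutrees\<close>

text \<open>At a vertex of maximal rank on a cycle, both incident cycle edges must point away from
  it. They share their tail, hence coincide, and the cycle is a loop, which the rank
  forbids.\<close>

lemma no_undirected_cycle_of_rank:
  fixes rk :: "'v \<Rightarrow> nat"
  assumes inj: "inj_on (tail G) (arcs G)"
    and rk: "\<And>e. e \<in> arcs G \<Longrightarrow> rk (head G e) < rk (tail G e)"
  shows "\<not> undirected_cycle G xs es"
proof
  assume c: "undirected_cycle G xs es"
  define m where "m = length xs"
  have m: "m > 0" "length es = m" using c by (auto simp: undirected_cycle_def m_def)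
  have es: "es ! j \<in> arcs G" if "j < m" for j
    using c that m by (auto simp: undirected_cycle_def)
  have ends: "{tail G (es ! j), head G (es ! j)} = {xs ! j, xs ! (Suc j mod m)}" if "j < m" for j
    using c that by (auto simp: undirected_cycle_def m_def)
  obtain j where j: "j < m" and max: "\<And>k. k < m \<Longrightarrow> rk (xs ! k) \<le> rk (xs ! j)"
  proof -
    have "Max ((\<lambda>k. rk (xs ! k)) ` {..<m}) \<in> (\<lambda>k. rk (xs ! k)) ` {..<m}"
      using m by (intro Max_in) auto
    then obtain j where "j < m" "rk (xs ! j) = Max ((\<lambda>k. rk (xs ! k)) ` {..<m})" by auto
    then show thesis by (intro that) auto
  qed
  have tail_max: "tail G (es ! k) = xs ! j"
    if "k < m" "xs ! j \<in> {tail G (es ! k), head G (es ! k)}" for k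
  proof -
    have "tail G (es ! k) \<in> {xs ! k, xs ! (Suc k mod m)}" using ends[OF that(1)] by blast
    then have "rk (tail G (es ! k)) \<le> rk (xs ! j)" using max[of k] max[of "Suc k mod m"] m that(1) by auto
    then show ?thesis using that(2) rk[OF es[OF that(1)]] by auto
  qed
  \<comment> \<open>Index of the cycle edge that precedes \<open>xs ! j\<close>, wrapping around at
    \<open>j = 0\<close>.\<close>
  define i where "i = (if j = 0 then m - 1 else j - 1)"
  have i: "i < m" "Suc i mod m = j" using j by (auto simp: i_def)
  have "tail G (es ! j) = xs ! j" using ends[OF j] j by (intro tail_max) auto
  moreover have "tail G (es ! i) = xs ! j" using ends[OF i(1)] i by (intro tail_max) auto
  ultimately have "es ! i = es ! j" by (metis inj_onD[OF inj] es i(1) j)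
  \<comment> \<open>An edge that is its own predecessor means that the cycle has length one.\<close>
  then have "i = j" using c i j m by (auto simp: undirected_cycle_def nth_eq_iff_index_eq)
  then have "tail G (es ! j) = head G (es ! j)" using ends[OF j] i by auto
  then show False using rk[OF es[OF j]] by simp
qed

text \<open>With at most one arc leaving each vertex, a directed walk iterates a partial function.
  The shortest return to the starting vertex repeats no vertex and is therefore an undirected
  cycle.\<close>

lemma acyclic_of_no_undirected_cycle:
  assumes "wf_digraph G" and inj: "inj_on (tail G) (arcs G)" and no: "\<nexists>xs es. undirected_cycle G xs es"
  shows "acyclic ((\<lambda>e. (tail G e, head G e)) ` arcs G)"
proof (rule acyclicI, intro allI notI)
  let ?R = "(\<lambda>e. (tail G e, head G e)) ` arcs G"
  interpret wf_digraph G by fact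
  fix v assume "(v, v) \<in> ?R\<^sup>+"
  \<comment> \<open>\<open>E x\<close> is the arc with tail \<open>x\<close> and \<open>p x\<close>
    its head; both are meaningful only if \<open>x\<close> is a tail.\<close>
  define E where "E = inv_into (arcs G) (tail G)"
  define p where "p x = head G (E x)" for x
  have E: "E (tail G e) = e" if "e \<in> arcs G" for e using that inj by (simp add: E_def)
  define P where "P k \<longleftrightarrow> 0 < k \<and> (p ^^ k) v = v \<and> (\<forall>j<k. (p ^^ j) v \<in> tail G ` arcs G)" for k
  have "(p ^^ k) x = y \<and> (\<forall>j<k. (p ^^ j) x \<in> tail G ` arcs G)" if "(x, y) \<in> ?R ^^ k" for x y k
    using that
  proof (induction k arbitrary: y)
    case (Suc k)
    then obtain e where "(x, tail G e) \<in> ?R ^^ k" "e \<in> arcs G" "y = head G e" by auto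
    then show ?case using Suc.IH[of "tail G e"] E by (auto simp: p_def less_Suc_eq)
  qed simp
  moreover obtain k where "k > 0" "(v, v) \<in> ?R ^^ k" using \<open>(v, v) \<in> ?R\<^sup>+\<close> by (auto simp: trancl_power)
  ultimately have "P k" by (simp add: P_def)
  define k where "k = (LEAST k. P k)"
  have "P k" unfolding k_def using \<open>P _\<close> by (rule LeastI)
  then have k: "k > 0" "(p ^^ k) v = v" "\<And>j. j < k \<Longrightarrow> (p ^^ j) v \<in> tail G ` arcs G"
    by (auto simp: P_def)
  have least: "\<not> P j" if "j < k" for j using that unfolding k_def by (rule not_less_Least)
  define xs where "xs = map (\<lambda>j. (p ^^ j) v) [0..<k]"
  have xs: "xs ! j = (p ^^ j) v" if "j < k" for j using that by (simp add: xs_def)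
  have "undirected_cycle G xs (map E xs)"
    unfolding undirected_cycle_def
  proof (intro conjI allI impI)
    show "xs \<noteq> []" "length (map E xs) = length xs" using k(1) by (auto simp: xs_def)
    \<comment> \<open>Skipping the stretch between two equal vertices would give the shorter return
      time \<open>k - j + i\<close>.\<close>
    have "(p ^^ i) v \<noteq> (p ^^ j) v" if "i < j" "j < k" for i j
    proof
      assume eq: "(p ^^ i) v = (p ^^ j) v"
      have "(p ^^ (k - j + i)) v = (p ^^ (k - j)) ((p ^^ j) v)" by (simp add: funpow_add eq)
      also have "\<dots> = (p ^^ (k - j + j)) v" by (simp only: funpow_add o_apply)
      also have "\<dots> = v" using that k(2) by simp
      finally have "P (k - j + i)" using that k(3) by (auto simp: P_def)
      moreover have "k - j + i < k" using that by auto
      ultimately show False using least by blast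
    qed
    then show "distinct xs" by (auto simp: distinct_conv_nth xs_def) (metis linorder_neqE_nat)
    have tails: "set xs \<subseteq> tail G ` arcs G" using k(3) by (auto simp: xs_def)
    then show "set xs \<subseteq> verts G" "set (map E xs) \<subseteq> arcs G" using E by auto
    have "inj_on E (tail G ` arcs G)" using E by (auto intro!: inj_onI)
    then show "distinct (map E xs)" using \<open>distinct xs\<close> tails
      by (auto simp: distinct_map intro: inj_on_subset)
    fix j assume "j < length xs"
    then have j: "j < k" by (simp add: xs_def)
    then have "tail G (E (xs ! j)) = xs ! j" using k(3)[OF j] E by (auto simp: xs)
    moreover have "head G (E (xs ! j)) = xs ! (Suc j mod length xs)"
    proof (cases "Suc j = k")
      case True
      then have "p ((p ^^ j) v) = v" using k(2) by auto
      then show ?thesis using True j xs[of 0] k(1) by (simp add: xs p_def xs_def[THEN arg_cong[of _ _ length]])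
    next
      case False
      then show ?thesis using j xs[of "Suc j"] by (simp add: xs p_def xs_def[THEN arg_cong[of _ _ length]])
    qed
    ultimately show "{tail G (map E xs ! j), head G (map E xs ! j)} = {xs ! j, xs ! (Suc j mod length xs)}"
      using \<open>j < length xs\<close> by simp
  qed
  then show False using no by blast
qed

section \<open>The edge set of a decorated tree\<close>

text \<open>An empty subtree is a dangling slot and yields no edge. The parent slot is
  \<open>Only\<close> because nodes decorated I or D have a single parent.\<close>

definition link :: "nat tree \<Rightarrow> nat \<Rightarrow> slot \<Rightarrow> tree_edge set" where
  "link t v s = (if t = Leaf then {} else {Tree_Edge (value t) Only v s})"

primrec edges :: "(nat \<Rightarrow> decoration) \<Rightarrow> nat tree \<Rightarrow> tree_edge set" where
  "edges \<delta> Leaf = {}"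
| "edges \<delta> (Node l v r) = link l v (if \<delta> v = Dec_D then Left else Only) \<union> link r v Right \<union>
     edges \<delta> l \<union> edges \<delta> r"

lemma value_in_set_tree: "t \<noteq> Leaf \<Longrightarrow> value t \<in> set_tree t"
  by (cases t) auto

lemma decorated_disjoint:
  "decorated \<delta> (Node l v r) \<Longrightarrow> v \<notin> set_tree l \<and> v \<notin> set_tree r \<and> set_tree l \<inter> set_tree r = {}"
  by (fastforce split: if_splits)

lemma link_edge: "e \<in> link t v s \<longleftrightarrow> t \<noteq> Leaf \<and> e = Tree_Edge (value t) Only v s"
  by (simp add: link_def)

lemma edges_endpoints:
  "e \<in> edges \<delta> t \<Longrightarrow> child e \<in> set_tree t \<and> parent e \<in> set_tree t \<and> parent_slot e = Only"
  by (induction t) (auto simp: link_edge value_in_set_tree)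

text \<open>Besides serving the injectivity of \<open>child\<close>, this recovers the root of a
  tree from its edge set in \<open>edges_inject\<close>.\<close>

lemma child_edges:
  "decorated \<delta> t \<Longrightarrow> t \<noteq> Leaf \<Longrightarrow> child ` edges \<delta> t = set_tree t - {value t}"
proof (induction t)
  case (Node l v r)
  \<comment> \<open>The edges inside \<open>u\<close> miss its root as a child; the link from
    \<open>u\<close> to \<open>v\<close> supplies it.\<close>
  have part: "child ` (link u v s \<union> edges \<delta> u) = set_tree u"
    if "u = Leaf \<or> child ` edges \<delta> u = set_tree u - {value u}" for u s
    using that value_in_set_tree[of u] by (cases "u = Leaf") (auto simp: link_def image_Un)
  have half: "child ` (link u v s \<union> edges \<delta> u) = set_tree u" if "u = l \<or> u = r" for u s
    by (rule part) (use that Node.IH Node.prems(1) in auto)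
  have "edges \<delta> (Node l v r) = (link l v (if \<delta> v = Dec_D then Left else Only) \<union> edges \<delta> l) \<union>
      (link r v Right \<union> edges \<delta> r)" by auto
  then have "child ` edges \<delta> (Node l v r) = set_tree l \<union> set_tree r"
    by (simp only: image_Un[of child "_ \<union> _"] half simp_thms)
  then show ?case using decorated_disjoint[OF Node.prems(1)] by auto
qed simp

lemma inj_on_child_edges: "decorated \<delta> t \<Longrightarrow> inj_on child (edges \<delta> t)"
proof (induction t)
  case (Node l v r)
  have half: "inj_on child (link u v s \<union> edges \<delta> u) \<and> child ` (link u v s \<union> edges \<delta> u) \<subseteq> set_tree u"
    if "decorated \<delta> u" "inj_on child (edges \<delta> u)" for u s
  proof (cases "u = Leaf")
    case False
    then show ?thesis using that child_edges[OF that(1) False] value_in_set_tree[OF False]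
      by (auto simp: link_def inj_on_def)
  qed (simp add: link_def)
  let ?L = "link l v (if \<delta> v = Dec_D then Left else Only) \<union> edges \<delta> l" and ?R = "link r v Right \<union> edges \<delta> r"
  have "inj_on child (?L \<union> ?R)"
  proof -
    have "inj_on child ?L" "child ` ?L \<subseteq> set_tree l" "inj_on child ?R" "child ` ?R \<subseteq> set_tree r"
      using half[of l] half[of r] Node by simp_all
    moreover have "set_tree l \<inter> set_tree r = {}" using decorated_disjoint[OF Node.prems] by blast
    ultimately show ?thesis by (subst inj_on_Un) blast
  qed
  moreover have "edges \<delta> (Node l v r) = ?L \<union> ?R" by auto
  ultimately show ?case by simp
qed simp

lemma inj_on_parent_edges:
  "decorated \<delta> t \<Longrightarrow> inj_on (\<lambda>e. (parent e, child_slot e)) (edges \<delta> t)"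
proof (induction t)
  case (Node l v r)
  note disj = decorated_disjoint[OF Node.prems]
  have IH: "inj_on (\<lambda>e. (parent e, child_slot e)) (edges \<delta> l)"
    "inj_on (\<lambda>e. (parent e, child_slot e)) (edges \<delta> r)"
    using Node by simp_all
  have Leaf: "r = Leaf" if "\<delta> v \<noteq> Dec_D" using Node.prems that by simp
  show ?case
  proof (rule inj_onI)
    fix e e' assume e: "e \<in> edges \<delta> (Node l v r)" "e' \<in> edges \<delta> (Node l v r)"
      and "(parent e, child_slot e) = (parent e', child_slot e')"
    then have eq: "parent e = parent e'" "child_slot e = child_slot e'" by auto
    \<comment> \<open>Labels are distinct, so edges with a common parent lie in the same part: at
      the root, in \<open>l\<close> or in \<open>r\<close>. Only the root edges then need their
      slots compared.\<close>
    have top: "x \<in> link l v (if \<delta> v = Dec_D then Left else Only) \<union> link r v Right \<longleftrightarrow> parent x = v"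
      and left: "x \<in> edges \<delta> l \<longleftrightarrow> parent x \<in> set_tree l"
      and right: "x \<in> edges \<delta> r \<longleftrightarrow> parent x \<in> set_tree r"
      if "x \<in> edges \<delta> (Node l v r)" for x
      using that disj edges_endpoints[of x \<delta> l] edges_endpoints[of x \<delta> r]
      by (auto simp: link_edge)
    consider "parent e = v" | "parent e \<in> set_tree l" | "parent e \<in> set_tree r"
      using edges_endpoints[OF e(1)] by auto
    then show "e = e'"
    proof cases
      case 1
      then show ?thesis using top[OF e(1)] top[OF e(2)] eq Leaf
        by (cases e; cases e'; cases "\<delta> v = Dec_D") (auto simp: link_edge)
    next
      case 2
      then show ?thesis using left[OF e(1)] left[OF e(2)] eq IH(1) by (simp add: inj_on_def)
    next
      case 3
      then show ?thesis using right[OF e(1)] right[OF e(2)] eq IH(2) by (simp add: inj_on_def)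
    qed
  qed
qed simp

lemma child_slot_edges:
  assumes "decorated \<delta> t" "\<forall>v\<in>set_tree t. \<delta> v \<in> {Dec_I, Dec_D}" "e \<in> edges \<delta> t"
  shows "child_slot e \<in> child_slots (\<delta> (parent e))"
  using assms by (induction t) (auto simp: link_edge child_slots_def split: if_splits)

text \<open>Depth is such a rank; it feeds \<open>no_undirected_cycle_of_rank\<close>.\<close>

lemma edges_rank:
  "decorated \<delta> t \<Longrightarrow> \<exists>rk :: nat \<Rightarrow> nat. \<forall>e\<in>edges \<delta> t. rk (parent e) < rk (child e)"
proof (induction t)
  case (Node l v r)
  have "decorated \<delta> l" "decorated \<delta> r" using Node.prems by simp_all
  with Node.IH obtain f g :: "nat \<Rightarrow> nat" where f: "\<forall>e\<in>edges \<delta> l. f (parent e) < f (child e)"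
    and g: "\<forall>e\<in>edges \<delta> r. g (parent e) < g (child e)" by blast
  \<comment> \<open>The ranks of the subtrees are shifted by one and glued along their disjoint
    label sets.\<close>
  let ?h = "\<lambda>x. if x = v then 0 else if x \<in> set_tree l then Suc (f x) else Suc (g x)"
  have "?h (parent e) < ?h (child e)" if "e \<in> edges \<delta> (Node l v r)" for e
  proof -
    note disj = decorated_disjoint[OF Node.prems]
    from that consider "e \<in> edges \<delta> l" | "e \<in> edges \<delta> r"
      | "e \<in> link l v (if \<delta> v = Dec_D then Left else Only)" | "e \<in> link r v Right" by auto
    then show ?thesis
    proof cases
      case 1
      then have "child e \<in> set_tree l" "parent e \<in> set_tree l" "f (parent e) < f (child e)"
        using f edges_endpoints by auto
      then show ?thesis using disj by auto
    next
      case 2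
      then have "child e \<in> set_tree r" "parent e \<in> set_tree r" "g (parent e) < g (child e)"
        using g edges_endpoints by auto
      then show ?thesis using disj by auto
    next
      case 3
      then have "child e \<in> set_tree l" "parent e = v" by (auto simp: link_edge value_in_set_tree)
      then show ?thesis using disj by auto
    next
      case 4
      then have "child e \<in> set_tree r" "parent e = v" by (auto simp: link_edge value_in_set_tree)
      then show ?thesis using disj by auto
    qed
  qed
  then show ?case by (intro exI[of _ ?h] ballI)
qed simp

lemma edges_connected:
  "x \<in> set_tree t \<Longrightarrow> (value t, x) \<in> ((\<lambda>e. (parent e, child e)) ` edges \<delta> t)\<^sup>*"
proof (induction t)
  case (Node l v r)
  let ?R = "\<lambda>t. (\<lambda>e. (parent e, child e)) ` edges \<delta> t"
  have sub: "(v, x) \<in> (?R (Node l v r))\<^sup>*"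
    if "x \<in> set_tree u" "(value u, x) \<in> (?R u)\<^sup>*" "link u v s \<union> edges \<delta> u \<subseteq> edges \<delta> (Node l v r)" for u s
  proof -
    have "u \<noteq> Leaf" using that by auto
    then have "Tree_Edge (value u) Only v s \<in> edges \<delta> (Node l v r)" using that(3) by (auto simp: link_def)
    then have "(v, value u) \<in> ?R (Node l v r)" by force
    moreover have "(value u, x) \<in> (?R (Node l v r))\<^sup>*"
      using that(2,3) rtrancl_mono[of "?R u" "?R (Node l v r)"] by blast
    ultimately show ?thesis by (rule converse_rtrancl_into_rtrancl)
  qed
  from Node.prems consider "x = v" | "x \<in> set_tree l" | "x \<in> set_tree r" by auto
  then show ?case
  proof cases
    case 2
    have "link l v (if \<delta> v = Dec_D then Left else Only) \<union> edges \<delta> l \<subseteq> edges \<delta> (Node l v r)" by auto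
    from sub[OF 2 Node.IH(1)[OF 2] this] show ?thesis by simp
  next
    case 3
    have "link r v Right \<union> edges \<delta> r \<subseteq> edges \<delta> (Node l v r)" by auto
    from sub[OF 3 Node.IH(2)[OF 3] this] show ?thesis by simp
  qed simp
qed simp

text \<open>Take for \<open>X\<close> the labels of the subtree hanging at the slot of
  \<open>e\<close>: once \<open>parent e\<close> is deleted, no edge joins \<open>X\<close> to the
  rest. That \<open>X\<close> avoids the root of \<open>t\<close> serves the induction, since an
  edge linking this root to a larger tree then has no end in \<open>X\<close>.\<close>

lemma edges_separated:
  assumes "decorated \<delta> t" "e \<in> edges \<delta> t" "\<delta> (parent e) = Dec_D"
  shows "\<exists>X. X \<subseteq> set_tree t - {value t} \<and> child e \<in> X \<and>
    (\<forall>j\<in>X. if child_slot e = Left then j < parent e else parent e < j) \<and>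
    (\<forall>e'\<in>edges \<delta> t. child e' \<noteq> parent e \<longrightarrow> parent e' \<noteq> parent e \<longrightarrow> (child e' \<in> X \<longleftrightarrow> parent e' \<in> X))"
  using assms
proof (induction t)
  case (Node l v r)
  note disj = decorated_disjoint[OF Node.prems(1)]
  have down: "\<exists>X. X \<subseteq> set_tree (Node l v r) - {value (Node l v r)} \<and> child e \<in> X \<and>
    (\<forall>j\<in>X. if child_slot e = Left then j < parent e else parent e < j) \<and>
    (\<forall>e'\<in>edges \<delta> (Node l v r). child e' \<noteq> parent e \<longrightarrow> parent e' \<noteq> parent e \<longrightarrow>
       (child e' \<in> X \<longleftrightarrow> parent e' \<in> X))"
    if "X \<subseteq> set_tree u - {value u}" "child e \<in> X"
      "\<forall>j\<in>X. if child_slot e = Left then j < parent e else parent e < j"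
      "\<forall>e'\<in>edges \<delta> u. child e' \<noteq> parent e \<longrightarrow> parent e' \<noteq> parent e \<longrightarrow> (child e' \<in> X \<longleftrightarrow> parent e' \<in> X)"
      "u = l \<or> u = r" for X u
  proof -
    \<comment> \<open>Such an edge has both ends outside \<open>X\<close>; for the link above
      \<open>u\<close> this holds because \<open>X\<close> omits the root of
      \<open>u\<close>.\<close>
    have "child e' \<in> X \<longleftrightarrow> parent e' \<in> X"
      if "e' \<in> edges \<delta> (Node l v r)" "e' \<notin> edges \<delta> u" for e'
    proof -
      have "child e' \<notin> set_tree u - {value u} \<and> parent e' \<notin> set_tree u"
        using that \<open>u = l \<or> u = r\<close> disj value_in_set_tree[of l] value_in_set_tree[of r]
        by (auto simp: link_edge dest: edges_endpoints)
      then show ?thesis using \<open>X \<subseteq> _\<close> by auto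
    qed
    then show ?thesis using that disj by (intro exI[of _ X]) auto
  qed
  from Node.prems(2) consider (l) "e \<in> edges \<delta> l" | (r) "e \<in> edges \<delta> r"
    | (top) "e \<in> link l v (if \<delta> v = Dec_D then Left else Only) \<union> link r v Right" by auto
  then show ?case
  proof cases
    case l
    then obtain X where "X \<subseteq> set_tree l - {value l} \<and> child e \<in> X \<and>
      (\<forall>j\<in>X. if child_slot e = Left then j < parent e else parent e < j) \<and>
      (\<forall>e'\<in>edges \<delta> l. child e' \<noteq> parent e \<longrightarrow> parent e' \<noteq> parent e \<longrightarrow> (child e' \<in> X \<longleftrightarrow> parent e' \<in> X))"
      using Node.IH(1) Node.prems by auto
    then show ?thesis using down[of X l] by blast
  next
    case r
    then obtain X where "X \<subseteq> set_tree r - {value r} \<and> child e \<in> X \<and>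
      (\<forall>j\<in>X. if child_slot e = Left then j < parent e else parent e < j) \<and>
      (\<forall>e'\<in>edges \<delta> r. child e' \<noteq> parent e \<longrightarrow> parent e' \<noteq> parent e \<longrightarrow> (child e' \<in> X \<longleftrightarrow> parent e' \<in> X))"
      using Node.IH(2) Node.prems by auto
    then show ?thesis using down[of X r] by blast
  next
    case top
    then have v: "parent e = v" "\<delta> v = Dec_D" using Node.prems(3) by (auto simp: link_edge)
    define X where "X = (if child_slot e = Left then set_tree l else set_tree r)"
    have "child e \<in> X" using top v(2) by (cases e) (auto simp: X_def link_edge value_in_set_tree)
    moreover have "\<forall>j\<in>X. if child_slot e = Left then j < v else v < j"
      using Node.prems(1) v by (auto simp: X_def)
    moreover have "X \<subseteq> set_tree (Node l v r) - {v}" using disj by (auto simp: X_def)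
    moreover have "child e' \<in> X \<longleftrightarrow> parent e' \<in> X"
      if "e' \<in> edges \<delta> (Node l v r)" "parent e' \<noteq> v" for e'
      using that disj by (auto simp: X_def link_edge dest: edges_endpoints)
    ultimately show ?thesis unfolding v by (intro exI[of _ X]) simp
  qed
qed simp

text \<open>The root is the only label that is not a child. At a D-node comparison with the root
  splits the other labels into the two subtrees, and at an I-node all of them lie in
  \<open>l\<close>; so the edges of each subtree are determined as well.\<close>

lemma edges_inject:
  assumes "decorated \<delta> t" "decorated \<delta> u" "set_tree t = set_tree u" "edges \<delta> t = edges \<delta> u"
  shows "t = u"
  using assms
proof (induction t arbitrary: u)
  case (Node l v r)
  then obtain l' v' r' where u: "u = Node l' v' r'" by (cases u) auto
  have "set_tree u - child ` edges \<delta> u = {v}" "set_tree u - child ` edges \<delta> u = {v'}"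
    using child_edges[OF Node.prems(1)] child_edges[OF Node.prems(2)] Node.prems(3,4) u
    by auto
  then have v: "v' = v" by simp
  note u = u[unfolded v]
  note dt = decorated_disjoint[OF Node.prems(1)] and du = decorated_disjoint[OF Node.prems(2)[unfolded u]]
  obtain E where E: "edges \<delta> (Node l v r) = E" "edges \<delta> (Node l' v r') = E"
    using Node.prems(4) unfolding u by blast
  \<comment> \<open>The root edges have parent \<open>v\<close>, so the parent end alone tells which
    edges belong to a subtree. Naming the common edge set \<open>E\<close> lets this fact apply to
    both trees.\<close>
  have restrict: "edges \<delta> x = {e \<in> E. parent e \<in> set_tree x}"
    if "decorated \<delta> (Node a v b)" "edges \<delta> (Node a v b) = E" "x = a \<or> x = b" for x a b
    unfolding that(2)[symmetric] using that(3) decorated_disjoint[OF that(1)]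
    by (auto simp: link_edge dest: edges_endpoints)
  obtain S where S: "set_tree (Node l v r) = S" "set_tree (Node l' v r') = S"
    using Node.prems(3) unfolding u by blast
  have sets: "set_tree l = set_tree l' \<and> set_tree r = set_tree r'"
  proof (cases "\<delta> v = Dec_D")
    case True
    have "set_tree a = {j \<in> S. j < v} \<and> set_tree b = {j \<in> S. v < j}"
      if "decorated \<delta> (Node a v b)" "set_tree (Node a v b) = S" for a b
      using that True by auto
    from this[OF Node.prems(1) S(1)] this[OF Node.prems(2)[unfolded u] S(2)] show ?thesis by simp
  next
    case False
    have "set_tree a = S - {v} \<and> set_tree b = {}"
      if "decorated \<delta> (Node a v b)" "set_tree (Node a v b) = S" for a b
      using that False by auto
    from this[OF Node.prems(1) S(1)] this[OF Node.prems(2)[unfolded u] S(2)] show ?thesis by simp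
  qed
  note restrict_l = restrict[OF Node.prems(1) E(1)]
    and restrict_u = restrict[OF Node.prems(2)[unfolded u] E(2)]
  have "edges \<delta> l = edges \<delta> l'" using restrict_l[of l] restrict_u[of l'] sets by simp
  moreover have "edges \<delta> r = edges \<delta> r'" using restrict_l[of r] restrict_u[of r'] sets by simp
  ultimately have "l = l'" "r = r'" using Node.IH sets Node.prems u by auto
  then show ?case by (simp add: u)
qed simp

section \<open>Decorated trees and permutrees correspond\<close>

lemma branch_tree_graph:
  "branch (tree_graph n T) v u = {w. (u, w) \<in> rtrancl_on ({1..n} - {v})
     (\<Union>e\<in>{e\<in>T. child e \<noteq> v \<and> parent e \<noteq> v}. {(child e, parent e), (parent e, child e)})}"
  by (simp add: branch_def reachable_def parcs_mk_symmetric pre_digraph.del_vert_def tree_graph_def)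

lemma connected_tree_graph:
  "connected (tree_graph n T) \<longleftrightarrow> {1..n} \<noteq> {} \<and> (\<forall>u\<in>{1..n}. \<forall>v\<in>{1..n}.
     (u, v) \<in> rtrancl_on {1..n} (\<Union>e\<in>T. {(child e, parent e), (parent e, child e)}))"
  by (simp add: connected_def strongly_connected_def reachable_def parcs_mk_symmetric tree_graph_def)

lemma wf_digraph_tree_graph:
  "wf_digraph (tree_graph n T) \<longleftrightarrow> (\<forall>e\<in>T. child e \<in> {1..n} \<and> parent e \<in> {1..n})"
  by (auto simp: wf_digraph_def tree_graph_def)

context
  fixes n :: nat and \<delta> :: "nat \<Rightarrow> decoration"
  assumes n: "n \<ge> 1" and ID: "\<forall>i\<in>{1..n}. \<delta> i \<in> {Dec_I, Dec_D}"
begin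

text \<open>A path that avoids \<open>i\<close> cannot leave the set \<open>X\<close> of
  \<open>edges_separated\<close>, whose labels are all on the right side of
  \<open>i\<close>.\<close>

lemma descendant_subtree_edges:
  assumes "decorated \<delta> t" "set_tree t = {1..n}" "\<delta> i = Dec_D" "j \<in> descendant_subtree n (edges \<delta> t) i s"
  shows "if s = Left then j < i else i < j"
proof -
  obtain e where e: "e \<in> edges \<delta> t" "parent e = i" "child_slot e = s"
    and j: "j \<in> branch (tree_graph n (edges \<delta> t)) i (child e)"
    using assms(4) by (auto simp: descendant_subtree_def)
  obtain X where X: "child e \<in> X" "\<forall>j\<in>X. if s = Left then j < i else i < j"
    and closed: "\<forall>e'\<in>edges \<delta> t. child e' \<noteq> i \<longrightarrow> parent e' \<noteq> i \<longrightarrow> (child e' \<in> X \<longleftrightarrow> parent e' \<in> X)"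
    using edges_separated[OF assms(1) e(1)] e(2,3) assms(3) by auto
  have "(child e, j) \<in> rtrancl_on ({1..n} - {i})
      (\<Union>e\<in>{e\<in>edges \<delta> t. child e \<noteq> i \<and> parent e \<noteq> i}. {(child e, parent e), (parent e, child e)})"
    using j by (simp add: branch_tree_graph)
  then have "j \<in> X"
    by (induction rule: rtrancl_on_induct) (use X(1) closed in auto)
  then show ?thesis using X(2) by blast
qed

lemma edges_in_permutrees:
  assumes t: "decorated \<delta> t" "set_tree t = {1..n}"
  shows "edges \<delta> t \<in> permutrees n \<delta>"
proof -
  let ?T = "edges \<delta> t"
  let ?S = "\<Union>e\<in>?T. {(child e, parent e), (parent e, child e)}"
  have ends: "child e \<in> {1..n}" "parent e \<in> {1..n}" "parent_slot e = Only" if "e \<in> ?T" for e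
    using edges_endpoints[OF that] t(2) by auto
  have root: "value t \<in> {1..n}" using value_in_set_tree[of t] t(2) n by (cases t) auto
  have reach: "(value t, x) \<in> rtrancl_on {1..n} ?S" if "x \<in> {1..n}" for x
  proof (rule rtrancl_consistent_rtrancl_on)
    have "(\<lambda>e. (parent e, child e)) ` ?T \<subseteq> ?S" by auto
    then show "(value t, x) \<in> ?S\<^sup>*" using edges_connected[of x t \<delta>] that t(2) rtrancl_mono by blast
    show "b \<in> {1..n}" if "(a, b) \<in> ?S" for a b using that ends by auto
  qed (use root that in auto)
  \<comment> \<open>Symmetry turns the paths from the root into paths between any two nodes.\<close>
  have "sym ?S" by (auto intro: symI)
  then have "sym (rtrancl_on {1..n} ?S)" by (rule rtrancl_on_sym)
  then have "(u, v) \<in> rtrancl_on {1..n} ?S" if "u \<in> {1..n}" "v \<in> {1..n}" for u v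
    using rtrancl_on_trans[OF symD[OF _ reach[OF that(1)]] reach[OF that(2)]] by blast
  then have "connected (tree_graph n ?T)" using n by (simp add: connected_tree_graph)
  moreover have "wf_digraph (tree_graph n ?T)" using ends by (simp add: wf_digraph_tree_graph)
  moreover have "\<nexists>xs es. undirected_cycle (tree_graph n ?T) xs es"
  proof -
    obtain rk :: "nat \<Rightarrow> nat" where rk: "\<forall>e\<in>?T. rk (parent e) < rk (child e)"
      using edges_rank[OF t(1)] by blast
    have "\<not> undirected_cycle (tree_graph n ?T) xs es" for xs es
      by (rule no_undirected_cycle_of_rank[where rk = rk])
        (use rk inj_on_child_edges[OF t(1)] in \<open>simp_all add: tree_graph_def\<close>)
    then show ?thesis by blast
  qed
  moreover have "parent_slot e \<in> parent_slots (\<delta> (child e)) \<and> child_slot e \<in> child_slots (\<delta> (parent e))"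
    if "e \<in> ?T" for e
  proof
    have "\<delta> (child e) \<in> {Dec_I, Dec_D}" using ends[OF that] ID by blast
    then show "parent_slot e \<in> parent_slots (\<delta> (child e))" using ends[OF that] by (auto simp: parent_slots_def)
    show "child_slot e \<in> child_slots (\<delta> (parent e))"
      using child_slot_edges[OF t(1) _ that] t(2) ID by blast
  qed
  moreover have "inj_on (\<lambda>e. (child e, parent_slot e)) ?T"
    using inj_on_child_edges[OF t(1)] by (simp add: inj_on_def)
  \<comment> \<open>No node has two parents, so the conditions on ancestor subtrees hold.\<close>
  moreover have "\<delta> i \<notin> {Dec_U, Dec_X}" if "i \<in> {1..n}" for i using ID that by force
  ultimately show ?thesis
    using inj_on_parent_edges[OF t(1)] descendant_subtree_edges[OF t]
    unfolding permutrees_def directed_tree_def by auto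
qed

text \<open>A node has one parent slot, hence at most one parent. With no cycles the parent relation
  is a finite rooted forest, which connectedness reduces to one tree; a binary tree is then
  assembled by well-founded recursion from the children upwards.\<close>

lemma permutree_obtain_tree:
  assumes "T \<in> permutrees n \<delta>"
  shows "\<exists>t. decorated \<delta> t \<and> set_tree t = {1..n} \<and> edges \<delta> t = T"
proof -
  let ?G = "tree_graph n T"
  let ?R = "(\<lambda>e. (child e, parent e)) ` T"
  have tree: "directed_tree ?G" and slots: "\<And>e. e \<in> T \<Longrightarrow>
      parent_slot e \<in> parent_slots (\<delta> (child e)) \<and> child_slot e \<in> child_slots (\<delta> (parent e))"
    and inj: "inj_on (\<lambda>e. (child e, parent_slot e)) T" "inj_on (\<lambda>e. (parent e, child_slot e)) T"
    and bst: "\<And>i j. i \<in> {1..n} \<Longrightarrow> \<delta> i = Dec_D \<Longrightarrow> j \<in> descendant_subtree n T i Left \<Longrightarrow> j < i"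
      "\<And>i j. i \<in> {1..n} \<Longrightarrow> \<delta> i = Dec_D \<Longrightarrow> j \<in> descendant_subtree n T i Right \<Longrightarrow> i < j"
    using assms unfolding permutrees_def by auto
  have ends: "child e \<in> {1..n}" "parent e \<in> {1..n}" if "e \<in> T" for e
    using tree that by (auto simp: directed_tree_def wf_digraph_tree_graph)
  have up: "parent_slot e = Only" if "e \<in> T" for e
  proof -
    have "\<delta> (child e) \<in> {Dec_I, Dec_D}" using ends[OF that] ID by blast
    then show ?thesis using slots[OF that] by (auto simp: parent_slots_def)
  qed
  then have inj_child: "inj_on child T" using inj(1) by (simp add: inj_on_def)
  then have "finite T" using ends by (meson finite_atLeastAtMost finite_imageD finite_subset image_subsetI)
  then have fin: "finite ?R" by simp
  have acyc: "acyclic ?R"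
    using acyclic_of_no_undirected_cycle[of ?G] tree inj_child by (simp add: directed_tree_def tree_graph_def)
  have single: "y = z" if "(x, y) \<in> ?R" "(x, z) \<in> ?R" for x y z
    using that inj_child by (auto dest: inj_onD)
  define below where "below v = {w. (w, v) \<in> ?R\<^sup>*}" for v
  have below_unfold: "below v = insert v (\<Union>e\<in>{e\<in>T. parent e = v}. below (child e))" for v
    unfolding below_def by (auto elim: rtranclE intro: rtrancl_into_rtrancl)
  have not_below: "v \<notin> below (child e)" if "e \<in> T" "parent e = v" for e v
  proof
    assume "v \<in> below (child e)"
    then have "(v, child e) \<in> ?R\<^sup>*" by (simp add: below_def)
    moreover have "(child e, v) \<in> ?R" using that by auto
    ultimately have "(v, v) \<in> ?R\<^sup>+" by (rule rtrancl_into_trancl1)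
    then show False using acyc by (simp add: acyclic_def)
  qed
  \<comment> \<open>By acyclicity a path below a child of \<open>v\<close> never meets
    \<open>v\<close>, so it survives the deletion of \<open>v\<close>. This carries the order
    conditions over to the sets \<open>below (child e)\<close>.\<close>
  have in_branch: "w \<in> branch ?G v (child e)" if e: "e \<in> T" "parent e = v" and "w \<in> below (child e)" for e v w
  proof -
    let ?S = "\<Union>e\<in>{e\<in>T. child e \<noteq> v \<and> parent e \<noteq> v}. {(child e, parent e), (parent e, child e)}"
    have "(w, child e) \<in> ?R\<^sup>*" using that(3) by (simp add: below_def)
    then have "(child e, w) \<in> rtrancl_on ({1..n} - {v}) ?S"
    proof (induction rule: converse_rtrancl_induct)
      case base
      have "child e \<in> below (child e)" by (simp add: below_def)
      then show ?case using ends[OF e(1)] not_below[OF e] by (intro rtrancl_on_refl) auto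
    next
      case (step y z)
      then have "y \<in> below (child e)" "z \<in> below (child e)"
        by (auto simp: below_def intro: converse_rtrancl_into_rtrancl)
      then have "y \<noteq> v" "z \<noteq> v" using not_below[OF e] by auto
      moreover obtain a where "a \<in> T" "child a = y" "parent a = z" using step.hyps by auto
      ultimately have "(z, y) \<in> ?S" "y \<in> {1..n} - {v}" using ends by auto
      then show ?case using step.IH by (meson rtrancl_on_into_rtrancl_on)
    qed
    then show ?thesis by (simp add: branch_tree_graph)
  qed
  have subtree: "\<exists>t. decorated \<delta> t \<and> t \<noteq> Leaf \<and> value t = v \<and> set_tree t = below v \<and>
      edges \<delta> t = {e\<in>T. parent e \<in> below v}" if "v \<in> {1..n}" for v
    using finite_acyclic_wf[OF fin acyc] that
  proof (induction v rule: wf_induct_rule)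
    case (less v)
    \<comment> \<open>The contribution of a single slot \<open>s\<close> of \<open>v\<close>: it
      holds at most one edge, whose child provides the tree by induction, and a dangling slot
      provides \<open>Leaf\<close>.\<close>
    have half: "\<exists>t. decorated \<delta> t \<and>
        set_tree t = (\<Union>e\<in>{e\<in>T. parent e = v \<and> child_slot e = s}. below (child e)) \<and>
        link t v s \<union> edges \<delta> t = {e\<in>T. parent e = v \<and> child_slot e = s} \<union>
          {a\<in>T. \<exists>e\<in>T. parent e = v \<and> child_slot e = s \<and> parent a \<in> below (child e)}" for s
    proof (cases "\<exists>e\<in>T. parent e = v \<and> child_slot e = s")
      case True
      then obtain e where e: "e \<in> T" "parent e = v" "child_slot e = s" by blast
      have uniq: "x = e" if "x \<in> T" "parent x = v" "child_slot x = s" for x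
        using inj_onD[OF inj(2), of x e] e that by simp
      then have only: "{e\<in>T. parent e = v \<and> child_slot e = s} = {e}" using e by blast
      have "(child e, v) \<in> ?R" using e by auto
      then obtain t where t: "decorated \<delta> t" "t \<noteq> Leaf" "value t = child e" "set_tree t = below (child e)"
        "edges \<delta> t = {a\<in>T. parent a \<in> below (child e)}"
        using less.IH ends[OF e(1)] by blast
      have "link t v s = {e}" using t(2,3) e up[OF e(1)] by (cases e) (simp add: link_def)
      moreover have "{a\<in>T. \<exists>e\<in>T. parent e = v \<and> child_slot e = s \<and> parent a \<in> below (child e)} =
          {a\<in>T. parent a \<in> below (child e)}"
        using e uniq by blast
      ultimately show ?thesis using t only by (intro exI[of _ t]) simp
    next
      case False
      then show ?thesis by (intro exI[of _ Leaf]) (auto simp: link_def)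
    qed
    have edges_below: "{e\<in>T. parent e \<in> below v} =
        {e\<in>T. parent e = v} \<union> {a\<in>T. \<exists>e\<in>T. parent e = v \<and> parent a \<in> below (child e)}"
      by (subst below_unfold) blast
    show ?case
    proof (cases "\<delta> v = Dec_D")
      case True
      then have lr: "child_slot e = Left \<or> child_slot e = Right" if "e \<in> T" "parent e = v" for e
        using slots[OF that(1)] that(2) by (simp add: child_slots_def)
      obtain l where l: "decorated \<delta> l"
        "set_tree l = (\<Union>e\<in>{e\<in>T. parent e = v \<and> child_slot e = Left}. below (child e))"
        "link l v Left \<union> edges \<delta> l = {e\<in>T. parent e = v \<and> child_slot e = Left} \<union>
          {a\<in>T. \<exists>e\<in>T. parent e = v \<and> child_slot e = Left \<and> parent a \<in> below (child e)}"
        using half[of Left] by blast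
      obtain r where r: "decorated \<delta> r"
        "set_tree r = (\<Union>e\<in>{e\<in>T. parent e = v \<and> child_slot e = Right}. below (child e))"
        "link r v Right \<union> edges \<delta> r = {e\<in>T. parent e = v \<and> child_slot e = Right} \<union>
          {a\<in>T. \<exists>e\<in>T. parent e = v \<and> child_slot e = Right \<and> parent a \<in> below (child e)}"
        using half[of Right] by blast
      have "set_tree l \<subseteq> descendant_subtree n T v Left" "set_tree r \<subseteq> descendant_subtree n T v Right"
        unfolding l(2) r(2) descendant_subtree_def using in_branch by blast+
      then have "\<forall>j\<in>set_tree l. j < v" "\<forall>j\<in>set_tree r. v < j" using bst less.prems True by blast+
      then have "decorated \<delta> (Node l v r)" using l(1) r(1) True by auto
      moreover have "set_tree (Node l v r) = below v"
        using lr by (subst below_unfold) (auto simp: l(2) r(2))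
      moreover have "edges \<delta> (Node l v r) = {e\<in>T. parent e \<in> below v}"
      proof -
        have "edges \<delta> (Node l v r) = (link l v Left \<union> edges \<delta> l) \<union> (link r v Right \<union> edges \<delta> r)"
          using True by auto
        also have "\<dots> = {e\<in>T. parent e \<in> below v}"
          unfolding l(3) r(3) edges_below using lr by blast
        finally show ?thesis .
      qed
      ultimately show ?thesis by (intro exI[of _ "Node l v r"]) simp
    next
      case False
      then have "\<delta> v = Dec_I" using ID less.prems by auto
      then have lr: "child_slot e = Only" if "e \<in> T" "parent e = v" for e
        using slots[OF that(1)] that(2) by (simp add: child_slots_def)
      obtain l where l: "decorated \<delta> l"
        "set_tree l = (\<Union>e\<in>{e\<in>T. parent e = v \<and> child_slot e = Only}. below (child e))"
        "link l v Only \<union> edges \<delta> l = {e\<in>T. parent e = v \<and> child_slot e = Only} \<union>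
          {a\<in>T. \<exists>e\<in>T. parent e = v \<and> child_slot e = Only \<and> parent a \<in> below (child e)}"
        using half[of Only] by blast
      have "v \<notin> set_tree l" using not_below by (auto simp: l(2))
      then have "decorated \<delta> (Node l v Leaf)" using l(1) False by simp
      moreover have "set_tree (Node l v Leaf) = below v"
        using lr by (subst below_unfold) (auto simp: l(2))
      moreover have "edges \<delta> (Node l v Leaf) = {e\<in>T. parent e \<in> below v}"
      proof -
        have "edges \<delta> (Node l v Leaf) = link l v Only \<union> edges \<delta> l"
          using False by (auto simp: link_def)
        also have "\<dots> = {e\<in>T. parent e \<in> below v}"
          unfolding l(3) edges_below using lr by blast
        finally show ?thesis .
      qed
      ultimately show ?thesis by (intro exI[of _ "Node l v Leaf"]) simp
    qed
  qed
  \<comment> \<open>The root is found by following parents from node \<open>1\<close> as far as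
    possible; this ends because the relation is finite and acyclic.\<close>
  obtain r where r: "(1, r) \<in> ?R\<^sup>*" "r \<notin> Domain ?R"
  proof -
    have "wf (?R\<inverse>)" using fin acyc by (rule finite_acyclic_wf_converse)
    then have "\<exists>z\<in>{z. (1, z) \<in> ?R\<^sup>*}. \<forall>y. (y, z) \<in> ?R\<inverse> \<longrightarrow> y \<notin> {z. (1, z) \<in> ?R\<^sup>*}"
      by (rule wf_eq_minimal[THEN iffD1, rule_format]) (rule CollectI, rule rtrancl_refl)
    then obtain z where z: "(1, z) \<in> ?R\<^sup>*" "\<forall>y. (z, y) \<in> ?R \<longrightarrow> (1, y) \<notin> ?R\<^sup>*" by blast
    then have "z \<notin> Domain ?R" by (meson DomainE rtrancl_into_rtrancl)
    then show thesis using z that by blast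
  qed
  have below_r: "below r = {1..n}"
  proof
    show "below r \<subseteq> {1..n}"
    proof
      fix w assume "w \<in> below r"
      moreover have "r \<in> {1..n}"
        using r(1) by (rule rtranclE) (use n ends in auto)
      ultimately show "w \<in> {1..n}"
        unfolding below_def using ends by (auto elim: converse_rtranclE)
    qed
    show "{1..n} \<subseteq> below r"
    proof
      fix x assume "x \<in> {1..n}"
      then have "(1, x) \<in> rtrancl_on {1..n} (\<Union>e\<in>T. {(child e, parent e), (parent e, child e)})"
        using tree n by (simp add: directed_tree_def connected_tree_graph)
      then show "x \<in> below r"
      proof (induction rule: rtrancl_on_induct)
        case base
        then show ?case using r by (simp add: below_def)
      next
        case (step y z)
        then obtain e where e: "e \<in> T" "(y = child e \<and> z = parent e) \<or> (y = parent e \<and> z = child e)" by auto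
        have edge: "(child e, parent e) \<in> ?R" using e(1) by auto
        have "(y, r) \<in> ?R\<^sup>*" using step.IH by (simp add: below_def)
        from e(2) show ?case
        proof
          assume y: "y = child e \<and> z = parent e"
          \<comment> \<open>Going up from \<open>y\<close> stays below \<open>r\<close>: since
            \<open>y\<close> is not the root, its path to \<open>r\<close> starts with an edge to
            its only parent, which is \<open>z\<close>.\<close>
          then have "y \<noteq> r" using r(2) edge by auto
          with \<open>(y, r) \<in> ?R\<^sup>*\<close> obtain u where u: "(y, u) \<in> ?R" "(u, r) \<in> ?R\<^sup>*"
            by (meson converse_rtranclE)
          have "(y, z) \<in> ?R" using edge y by simp
          with u(1) have "u = z" by (rule single)
          then show ?case using u(2) by (simp add: below_def)
        next
          assume y: "y = parent e \<and> z = child e"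
          then have "(z, y) \<in> ?R" using edge by simp
          then have "(z, r) \<in> ?R\<^sup>*"
            using \<open>(y, r) \<in> ?R\<^sup>*\<close> by (rule converse_rtrancl_into_rtrancl)
          then show ?case by (simp add: below_def)
        qed
      qed
    qed
  qed
  have "r \<in> {1..n}" using below_r by (auto simp: below_def)
  then obtain t where t: "decorated \<delta> t" "set_tree t = below r" "edges \<delta> t = {e\<in>T. parent e \<in> below r}"
    using subtree by blast
  moreover have "{e\<in>T. parent e \<in> below r} = T" using ends by (auto simp: below_r)
  ultimately show ?thesis using below_r by auto
qed

lemma bij_betw_edges:
  "bij_betw (edges \<delta>) {t. decorated \<delta> t \<and> set_tree t = {1..n}} (permutrees n \<delta>)"
proof (rule bij_betw_imageI)
  show "inj_on (edges \<delta>) {t. decorated \<delta> t \<and> set_tree t = {1..n}}"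
    by (rule inj_onI) (auto intro: edges_inject)
  show "edges \<delta> ` {t. decorated \<delta> t \<and> set_tree t = {1..n}} = permutrees n \<delta>"
    using edges_in_permutrees permutree_obtain_tree by blast
qed

end

section \<open>Flows of the bicho graph\<close>

text \<open>An M-move on \<open>Dip i\<close> affects only this arc and the two names formed from
  it, so moves on different dips do not interact. All components go through one induction over an
  arbitrary starting graph, because the fold changes the graph at each step.\<close>

lemma fold_M_move_Dip:
  fixes G :: "(nat, arc_name) pre_digraph" and n :: nat and xs :: "nat list"
  defines "H \<equiv> fold (M_move n) (map Dip xs) G"
  shows "verts (H) = verts G"
    and "arcs (H) = (arcs G - Dip ` set xs) \<union> (\<lambda>i. From_source (Dip i)) ` set xs
           \<union> (\<lambda>i. To_sink (Dip i)) ` set xs"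
    and "tail (H) (Bump i) = tail G (Bump i)"
    and "tail (H) (Dip i) = tail G (Dip i)"
    and "tail (H) (From_source (Dip i)) = (if i \<in> set xs then 0 else tail G (From_source (Dip i)))"
    and "tail (H) (To_sink (Dip i)) =
           (if i \<in> set xs then tail G (Dip i) else tail G (To_sink (Dip i)))"
    and "head (H) (Bump i) = head G (Bump i)"
    and "head (H) (Dip i) = head G (Dip i)"
    and "head (H) (From_source (Dip i)) =
           (if i \<in> set xs then head G (Dip i) else head G (From_source (Dip i)))"
    and "head (H) (To_sink (Dip i)) = (if i \<in> set xs then n else head G (To_sink (Dip i)))"
  unfolding H_def by (atomize (full), induction xs arbitrary: G) (auto simp: M_move_def)

text \<open>Every arc is counted once at its tail and once, with the opposite sign, at its
  head.\<close>

lemma sum_conservation: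
  fixes f :: "'e \<Rightarrow> int"
  assumes "fin_digraph G"
  shows "(\<Sum>v\<in>verts G. (\<Sum>e\<in>out_arcs G v. f e) - (\<Sum>e\<in>in_arcs G v. f e)) = 0"
proof -
  interpret fin_digraph G by fact
  have "(\<Sum>v\<in>verts G. \<Sum>e\<in>out_arcs G v. f e) = (\<Sum>e\<in>arcs G. f e)"
    unfolding out_arcs_def by (rule sum.group) auto
  moreover have "(\<Sum>v\<in>verts G. \<Sum>e\<in>in_arcs G v. f e) = (\<Sum>e\<in>arcs G. f e)"
    unfolding in_arcs_def by (rule sum.group) auto
  ultimately show ?thesis by (simp add: sum_subtractf)
qed

text \<open>The edge that leaves \<open>v\<^bsub>n-i\<^esub>\<close> besides the bump \<open>e\<^sup>i\<^sub>0\<close>.\<close>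

definition spare :: "(nat \<Rightarrow> decoration) \<Rightarrow> nat \<Rightarrow> arc_name" where
  "spare \<delta> i = (if \<delta> i = Dec_D then To_sink (Dip i) else Dip i)"

context
  fixes n :: nat and \<delta> :: "nat \<Rightarrow> decoration"
  assumes n: "n \<ge> 2" and ID: "\<forall>i\<in>{1..n}. \<delta> i \<in> {Dec_I, Dec_D}"
begin

lemma Bic_eq:
  "Bic n \<delta> = fold (M_move n) (map Dip (filter (\<lambda>i. \<delta> i = Dec_D) [1..<Suc n])) (oruga n)"
proof -
  have dec: "\<delta> i = Dec_I \<or> \<delta> i = Dec_D" if "i \<in> set [1..<Suc n]" for i
    using ID that by (simp del: upt_Suc)
  have "filter (\<lambda>i. \<delta> i \<in> {Dec_U, Dec_X}) [1..<Suc n] = []"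
    by (rule filter_False) (use dec in \<open>fastforce simp del: set_upt upt_Suc\<close>)
  moreover have "filter (\<lambda>i. \<delta> i \<in> {Dec_D, Dec_X}) [1..<Suc n] = filter (\<lambda>i. \<delta> i = Dec_D) [1..<Suc n]"
    by (rule filter_cong) (use dec in \<open>fastforce simp del: set_upt upt_Suc\<close>)+
  ultimately show ?thesis by (simp add: Bic_def)
qed

lemma verts_Bic: "verts (Bic n \<delta>) = {0..n}"
  by (simp add: Bic_eq fold_M_move_Dip oruga_def)

lemma arcs_Bic: "arcs (Bic n \<delta>) = Bump ` {1..n} \<union> spare \<delta> ` {1..n} \<union>
    (\<lambda>i. From_source (Dip i)) ` {i\<in>{1..n}. \<delta> i = Dec_D}"
  by (auto simp: Bic_eq fold_M_move_Dip oruga_def spare_def)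

lemma
  assumes "i \<in> {1..n}"
  shows tail_Bump: "tail (Bic n \<delta>) (Bump i) = n - i"
    and tail_spare: "tail (Bic n \<delta>) (spare \<delta> i) = n - i"
    and tail_source: "\<delta> i = Dec_D \<Longrightarrow> tail (Bic n \<delta>) (From_source (Dip i)) = 0"
    and head_Bump: "head (Bic n \<delta>) (Bump i) = n + 1 - i"
    and head_spare: "head (Bic n \<delta>) (spare \<delta> i) = (if \<delta> i = Dec_D then n else n + 1 - i)"
    and head_source: "\<delta> i = Dec_D \<Longrightarrow> head (Bic n \<delta>) (From_source (Dip i)) = n + 1 - i"
  using assms by (auto simp: Bic_eq fold_M_move_Dip oruga_def spare_def)

lemmas ends_Bic = tail_Bump tail_spare tail_source head_Bump head_spare head_source

lemma fin_digraph_Bic: "fin_digraph (Bic n \<delta>)"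
proof
  show "finite (verts (Bic n \<delta>))" "finite (arcs (Bic n \<delta>))" by (simp_all add: verts_Bic arcs_Bic)
  show "tail (Bic n \<delta>) e \<in> verts (Bic n \<delta>)" "head (Bic n \<delta>) e \<in> verts (Bic n \<delta>)"
    if "e \<in> arcs (Bic n \<delta>)" for e
    using that unfolding arcs_Bic by (auto simp: ends_Bic verts_Bic)
qed

lemma out_arcs_Bic:
  assumes "i \<in> {1..<n}"
  shows "out_arcs (Bic n \<delta>) (n - i) = {Bump i, spare \<delta> i}"
proof -
  have "n - j = n - i \<longleftrightarrow> j = i" if "j \<in> {1..n}" for j using that assms by auto
  \<comment> \<open>This excludes the arcs that M-moves let start at the source.\<close>
  moreover have "0 < n - i" using assms by simp
  ultimately show ?thesis using assms by (auto simp: out_arcs_def arcs_Bic ends_Bic)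
qed

lemma out_arcs_Bic_0:
  "out_arcs (Bic n \<delta>) 0 =
     {Bump n, spare \<delta> n} \<union> (\<lambda>i. From_source (Dip i)) ` {i\<in>{1..n}. \<delta> i = Dec_D}"
proof -
  have "n - j = 0 \<longleftrightarrow> j = n" if "j \<in> {1..n}" for j using that by auto
  then show ?thesis using n by (auto simp: out_arcs_def arcs_Bic ends_Bic)
qed

lemma in_arcs_Bic:
  assumes "i \<in> {1..<n}"
  shows "in_arcs (Bic n \<delta>) (n - i) =
    {Bump (Suc i), if \<delta> (Suc i) = Dec_D then From_source (Dip (Suc i)) else Dip (Suc i)}"
proof -
  have "n + 1 - j = n - i \<longleftrightarrow> j = Suc i" if "j \<in> {1..n}" for j using that assms by auto
  \<comment> \<open>This excludes the arcs that M-moves let end at the sink; the second fact covers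
    the arcs with index \<open>Suc i\<close>.\<close>
  moreover have "n \<noteq> n - i" "Suc i \<in> {1..n}" using assms by auto
  ultimately have "{e \<in> Bump ` {1..n}. head (Bic n \<delta>) e = n - i} = {Bump (Suc i)}"
    "{e \<in> spare \<delta> ` {1..n}. head (Bic n \<delta>) e = n - i} =
       (if \<delta> (Suc i) = Dec_D then {} else {spare \<delta> (Suc i)})"
    "{e \<in> (\<lambda>i. From_source (Dip i)) ` {i\<in>{1..n}. \<delta> i = Dec_D}. head (Bic n \<delta>) e = n - i} =
       (if \<delta> (Suc i) = Dec_D then {From_source (Dip (Suc i))} else {})"
    by (auto simp: ends_Bic split: if_splits)
  then have "in_arcs (Bic n \<delta>) (n - i) = {Bump (Suc i)} \<union>
      (if \<delta> (Suc i) = Dec_D then {} else {spare \<delta> (Suc i)}) \<union>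
      (if \<delta> (Suc i) = Dec_D then {From_source (Dip (Suc i))} else {})"
    unfolding in_arcs_def arcs_Bic by blast
  then show ?thesis by (auto simp: spare_def)
qed

lemma conservation_Bic:
  fixes f :: "arc_name \<Rightarrow> int"
  assumes "i \<in> {1..<n}"
  shows "(\<Sum>e\<in>out_arcs (Bic n \<delta>) (n - i). f e) - (\<Sum>e\<in>in_arcs (Bic n \<delta>) (n - i). f e) =
    f (Bump i) + f (spare \<delta> i) - f (Bump (Suc i)) -
      f (if \<delta> (Suc i) = Dec_D then From_source (Dip (Suc i)) else Dip (Suc i))"
proof -
  have "Bump i \<noteq> spare \<delta> i" by (simp add: spare_def)
  then show ?thesis by (simp add: out_arcs_Bic[OF assms] in_arcs_Bic[OF assms])
qed

text \<open>Nothing enters the source and its demand is zero, so all arcs leaving it carry zero.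
  Conservation at the inner vertices then becomes a recurrence in \<open>i\<close>, and the balance
  at the sink follows from the others.\<close>

lemma integer_flows_Bic_iff:
  "f \<in> integer_flows (Bic n \<delta>) (netflow n) \<longleftrightarrow>
     f \<in> arcs (Bic n \<delta>) \<rightarrow>\<^sub>E {0..} \<and> f (Bump n) = 0 \<and> f (spare \<delta> n) = 0 \<and>
     (\<forall>i\<in>{1..n}. \<delta> i = Dec_D \<longrightarrow> f (From_source (Dip i)) = 0) \<and>
     (\<forall>i\<in>{1..<n}. f (Bump i) + f (spare \<delta> i) =
        1 + f (Bump (Suc i)) + (if \<delta> (Suc i) = Dec_D then 0 else f (Dip (Suc i))))"
  (is "?L \<longleftrightarrow> ?E \<and> ?B \<and> ?S \<and> ?F \<and> ?C")
proof -
  let ?G = "Bic n \<delta>"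
  let ?net = "\<lambda>v. (\<Sum>e\<in>out_arcs ?G v. f e) - (\<Sum>e\<in>in_arcs ?G v. f e)"
  have "in_arcs ?G 0 = {}"
  proof -
    have "head ?G e \<noteq> 0" if "e \<in> arcs ?G" for e
      using that n unfolding arcs_Bic by (auto simp: ends_Bic)
    then show ?thesis by (auto simp: in_arcs_def)
  qed
  then have net0: "?net 0 = (\<Sum>e\<in>out_arcs ?G 0. f e)" by simp
  have zero: "?net 0 = 0 \<longleftrightarrow> ?B \<and> ?S \<and> ?F" if ?E
  proof -
    have "finite (out_arcs ?G 0)" by (simp add: out_arcs_Bic_0)
    moreover have "f e \<ge> 0" if "e \<in> out_arcs ?G 0" for e
      using that \<open>?E\<close> by (auto simp: out_arcs_def)
    ultimately have "?net 0 = 0 \<longleftrightarrow> (\<forall>e\<in>out_arcs ?G 0. f e = 0)"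
      unfolding net0 by (rule sum_nonneg_eq_0_iff)
    also have "\<dots> \<longleftrightarrow> ?B \<and> ?S \<and> ?F" unfolding out_arcs_Bic_0 by auto
    finally show ?thesis .
  qed
  have mid: "?net (n - i) = 1 \<longleftrightarrow> f (Bump i) + f (spare \<delta> i) =
        1 + f (Bump (Suc i)) + (if \<delta> (Suc i) = Dec_D then 0 else f (Dip (Suc i)))"
    if "?F" "i \<in> {1..<n}" for i
  proof -
    have "\<delta> (Suc i) = Dec_D \<longrightarrow> f (From_source (Dip (Suc i))) = 0" using that by auto
    then show ?thesis unfolding conservation_Bic[OF that(2)] by auto
  qed
  have inner: "(\<forall>v\<in>{1..<n}. ?net v = 1) \<longleftrightarrow> ?C" if ?F
  proof -
    \<comment> \<open>Reindexing by \<open>v = n - i\<close> passes from vertices to labels.\<close>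
    have "(\<forall>v\<in>{1..<n}. ?net v = 1) \<longleftrightarrow> (\<forall>i\<in>{1..<n}. ?net (n - i) = 1)"
    proof (intro iffI ballI)
      fix v assume a: "\<forall>i\<in>{1..<n}. ?net (n - i) = 1" and "v \<in> {1..<n}"
      then have "n - v \<in> {1..<n}" "n - (n - v) = v" by auto
      then show "?net v = 1" using a by metis
    qed auto
    then show ?thesis using mid[OF that] by blast
  qed
  have verts: "{0..n} = insert 0 (insert n {1..<n})" using n by auto
  \<comment> \<open>All net outflows add up to zero, and the \<open>n - 1\<close> inner vertices
    contribute one each.\<close>
  have last: "?net n = - (int n - 1)" if "?net 0 = 0" "\<forall>v\<in>{1..<n}. ?net v = 1"
  proof -
    have "0 = sum ?net {0..n}" using sum_conservation[OF fin_digraph_Bic, of f] by (simp add: verts_Bic)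
    also have "\<dots> = ?net 0 + ?net n + sum ?net {1..<n}" unfolding verts using n by simp
    also have "sum ?net {1..<n} = (\<Sum>v\<in>{1..<n}. 1)" using that(2) by (intro sum.cong) auto
    also have "\<dots> = int n - 1" using n by simp
    finally show ?thesis using that(1) by simp
  qed
  have "?L \<longleftrightarrow> ?E \<and> ?net 0 = 0 \<and> ?net n = - (int n - 1) \<and> (\<forall>v\<in>{1..<n}. ?net v = 1)"
    unfolding integer_flows_def verts_Bic verts using n by (auto simp: netflow_def)
  also have "\<dots> \<longleftrightarrow> ?E \<and> ?net 0 = 0 \<and> (\<forall>v\<in>{1..<n}. ?net v = 1)" using last by blast
  also have "\<dots> \<longleftrightarrow> ?E \<and> ?B \<and> ?S \<and> ?F \<and> ?C" using zero inner by blast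
  finally show ?thesis .
qed

section \<open>Flows as sequences of insertion depths\<close>

text \<open>Label \<open>1\<close> comes first and \<open>n\<close> last, as \<open>build\<close>
  expects. Flows are nonnegative, so \<open>nat\<close> loses nothing on their arcs.\<close>

definition code :: "(arc_name \<Rightarrow> int) \<Rightarrow> nat list" where
  "code f = map (\<lambda>i. nat (f (Bump i))) [1..<Suc n]"

text \<open>Downward induction from \<open>i = n\<close>, where the tree is empty and the outflow is
  zero. The list \<open>ks i\<close> holds the depths of the labels above \<open>i\<close>. The
  equation is restricted to \<open>i \<ge> 1\<close> because at \<open>i = 0\<close> the vertex is
  the sink, which has no bump leaving it.\<close>

lemma admissible_flow:
  assumes f: "f \<in> integer_flows (Bic n \<delta>) (netflow n)" and "i \<le> n"
  defines "ks \<equiv> \<lambda>i. map (\<lambda>i. nat (f (Bump i))) [Suc i..<Suc n]"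
  shows "admissible \<delta> n (ks i) \<and>
    (i \<ge> 1 \<longrightarrow> f (Bump i) + f (spare \<delta> i) = int (spine (build \<delta> n (ks i))))"
  using \<open>i \<le> n\<close>
proof (induction rule: inc_induct)
  case base
  then show ?case using f by (simp add: ks_def integer_flows_Bic_iff)
next
  case (step i)
  have nonneg: "f e \<ge> 0" if "e \<in> arcs (Bic n \<delta>)" for e
    using f that by (auto simp: integer_flows_def)
  have i: "Suc i \<in> {1..n}" using step by auto
  then have pos: "f (Bump (Suc i)) \<ge> 0" "f (spare \<delta> (Suc i)) \<ge> 0"
    by (auto intro!: nonneg simp: arcs_Bic)
  have out: "f (Bump (Suc i)) + f (spare \<delta> (Suc i)) = int (spine (build \<delta> n (ks (Suc i))))"
    using step.IH by simp
  have ks: "ks i = nat (f (Bump (Suc i))) # ks (Suc i)"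
    using step.hyps unfolding ks_def by (simp add: upt_conv_Cons del: upt_Suc)
  have le: "nat (f (Bump (Suc i))) \<le> spine (build \<delta> n (ks (Suc i)))"
    using pos out by linarith
  \<comment> \<open>The labels above \<open>Suc i\<close> are already placed, so
    \<open>Suc i\<close> is the next label to insert.\<close>
  have lab: "n - length (ks (Suc i)) = Suc i" using step.hyps by (simp add: ks_def del: upt_Suc)
  have adm: "admissible \<delta> n (ks i)" using step.IH le unfolding ks by simp
  have "f (Bump i) + f (spare \<delta> i) = int (spine (build \<delta> n (ks i)))" if "i \<ge> 1"
  proof -
    have "f (Bump i) + f (spare \<delta> i) =
        1 + f (Bump (Suc i)) + (if \<delta> (Suc i) = Dec_D then 0 else f (Dip (Suc i)))"
      using f that step.hyps by (simp add: integer_flows_Bic_iff)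
    \<comment> \<open>If \<open>Suc i\<close> is a D-node, both sides are one more than its bump
      value; otherwise both are one more than bump plus dip, which is the previous spine.\<close>
    then show ?thesis unfolding ks using out pos lab
      by (auto simp: spine_ins[OF le] spare_def)
  qed
  then show ?case using adm by blast
qed

lemma admissible_code:
  "f \<in> integer_flows (Bic n \<delta>) (netflow n) \<Longrightarrow> length (code f) = n \<and> admissible \<delta> n (code f)"
  using admissible_flow[of f 0] by (simp add: code_def del: upt_Suc)

text \<open>The code fixes the bumps, and the spine lengths of the trees built from it fix the sums
  of bump and spare arc. The remaining arcs carry zero.\<close>

lemma inj_on_code: "inj_on code (integer_flows (Bic n \<delta>) (netflow n))"
proof (rule inj_onI)
  fix f g assume f: "f \<in> integer_flows (Bic n \<delta>) (netflow n)"
    and g: "g \<in> integer_flows (Bic n \<delta>) (netflow n)" and "code f = code g"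
  then have nat: "nat (f (Bump i)) = nat (g (Bump i))" if "i \<in> {1..n}" for i
    using that by (auto simp: code_def simp del: upt_Suc)
  have bump: "f (Bump i) = g (Bump i)" if "i \<in> {1..n}" for i
  proof -
    have "Bump i \<in> arcs (Bic n \<delta>)" using that by (simp add: arcs_Bic)
    then have "f (Bump i) \<ge> 0" "g (Bump i) \<ge> 0" using f g by (auto simp: integer_flows_def)
    then show ?thesis using nat[OF that] by simp
  qed
  have spare: "f (spare \<delta> i) = g (spare \<delta> i)" if "i \<in> {1..n}" for i
  proof -
    have eq: "map (\<lambda>i. nat (f (Bump i))) [Suc i..<Suc n] = map (\<lambda>i. nat (g (Bump i))) [Suc i..<Suc n]"
      using nat by (auto simp del: upt_Suc)
    have "1 \<le> i" "i \<le> n" using that by auto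
    then have "f (Bump i) + f (spare \<delta> i) = g (Bump i) + g (spare \<delta> i)"
      using admissible_flow[OF f, of i] admissible_flow[OF g, of i] unfolding eq by simp
    then show ?thesis using bump[OF that] by simp
  qed
  show "f = g"
  proof
    fix e show "f e = g e"
    proof (cases "e \<in> arcs (Bic n \<delta>)")
      case True
      then consider i where "i \<in> {1..n}" "e = Bump i" | i where "i \<in> {1..n}" "e = spare \<delta> i"
        | i where "i \<in> {1..n}" "\<delta> i = Dec_D" "e = From_source (Dip i)"
        unfolding arcs_Bic by blast
      then show ?thesis using bump spare f g
        by cases (auto simp: integer_flows_Bic_iff)
    next
      case False
      then show ?thesis using f g by (auto simp: integer_flows_def PiE_def extensional_def)
    qed
  qed
qed

text \<open>The flow is read off the growing tree: the bump carries the insertion depth and the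
  spare arc the rest of the spine, a nonnegative amount by admissibility.\<close>

lemma code_surj:
  assumes "length ks = n" "admissible \<delta> n ks"
  shows "ks \<in> code ` integer_flows (Bic n \<delta>) (netflow n)"
proof -
  \<comment> \<open>\<open>b i\<close> is the depth at which label \<open>i\<close> is inserted,
    stored at position \<open>i - 1\<close>, and \<open>s i\<close> is the spine length just before
    that insertion.\<close>
  define b where "b i = ks ! (i - 1)" for i
  define s where "s i = spine (build \<delta> n (drop i ks))" for i
  have adm: "admissible \<delta> n (drop i ks)" for i
  proof (induction i)
    case (Suc i)
    then show ?case
      by (cases "drop i ks") (auto simp flip: drop_drop tl_drop simp: drop_Suc)
  qed (simp add: assms)
  have drop: "drop i ks = b (Suc i) # drop (Suc i) ks" if "i < n" for i
    using that assms(1) by (simp add: b_def Cons_nth_drop_Suc)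
  have le: "b i \<le> s i" if "i \<in> {1..n}" for i
  proof -
    have "i - 1 < n" "Suc (i - 1) = i" using that by auto
    then show ?thesis using adm[of "i - 1"] drop[of "i - 1"] by (simp add: s_def)
  qed
  have sn: "s n = 0" using assms(1) by (simp add: s_def)
  have step: "s i = (if \<delta> (Suc i) = Dec_D then Suc (b (Suc i)) else Suc (s (Suc i)))" if "i < n" for i
  proof -
    have "n - length (drop (Suc i) ks) = Suc i" using that assms(1) by simp
    moreover have "b (Suc i) \<le> spine (build \<delta> n (drop (Suc i) ks))"
      using le[of "Suc i"] that by (simp add: s_def)
    ultimately show ?thesis unfolding s_def drop[OF that] by (simp add: spine_ins)
  qed
  \<comment> \<open>Dips and arcs to the sink get the same formula, since either may be the spare
    arc; the restriction to the arcs discards the other names.\<close>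
  define g where "g e = (case e of Bump i \<Rightarrow> int (b i) | From_source e \<Rightarrow> 0
    | _ \<Rightarrow> int (s (arc_index e)) - int (b (arc_index e)))" for e
  define f where "f = restrict g (arcs (Bic n \<delta>))"
  have fg: "f e = g e" if "e \<in> arcs (Bic n \<delta>)" for e using that by (simp add: f_def)
  have bump: "f (Bump i) = int (b i)" if "i \<in> {1..n}" for i
    using that by (subst fg) (auto simp: arcs_Bic g_def)
  have spare: "f (spare \<delta> i) = int (s i) - int (b i)" if "i \<in> {1..n}" for i
    using that by (subst fg) (auto simp: arcs_Bic g_def spare_def)
  have source: "f (From_source (Dip i)) = 0" if "i \<in> {1..n}" "\<delta> i = Dec_D" for i
    using that by (subst fg) (auto simp: arcs_Bic g_def)
  have dip: "f (Dip i) = int (s i) - int (b i)" if "i \<in> {1..n}" "\<delta> i \<noteq> Dec_D" for i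
    using spare[OF that(1)] that(2) by (simp add: spare_def)
  have "f \<in> arcs (Bic n \<delta>) \<rightarrow>\<^sub>E {0..}"
  proof (rule PiE_I)
    fix e assume "e \<in> arcs (Bic n \<delta>)"
    then consider i where "i \<in> {1..n}" "e = Bump i" | i where "i \<in> {1..n}" "e = spare \<delta> i"
      | i where "i \<in> {1..n}" "\<delta> i = Dec_D" "e = From_source (Dip i)"
      unfolding arcs_Bic by blast
    then show "f e \<in> {0..}" using bump spare source le by cases auto
  qed (simp add: f_def)
  \<comment> \<open>Label \<open>n\<close> enters the empty tree, so \<open>s n = 0\<close> forces
    \<open>b n = 0\<close>.\<close>
  moreover have "f (Bump n) = 0" "f (spare \<delta> n) = 0" using n le[of n] sn bump[of n] spare[of n] by auto
  moreover have "f (Bump i) + f (spare \<delta> i) =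
      1 + f (Bump (Suc i)) + (if \<delta> (Suc i) = Dec_D then 0 else f (Dip (Suc i)))"
    if "i \<in> {1..<n}" for i
    using that bump[of i] spare[of i] bump[of "Suc i"] dip[of "Suc i"] step[of i] by auto
  ultimately have "f \<in> integer_flows (Bic n \<delta>) (netflow n)"
    using source by (simp add: integer_flows_Bic_iff)
  moreover have "code f = ks"
    by (rule nth_equalityI) (use assms(1) bump in \<open>auto simp: code_def b_def simp del: upt_Suc\<close>)
  ultimately show ?thesis by blast
qed

lemma bij_betw_code:
  "bij_betw code (integer_flows (Bic n \<delta>) (netflow n)) {ks. length ks = n \<and> admissible \<delta> n ks}"
  unfolding bij_betw_def using inj_on_code admissible_code code_surj by blast

end

theorem theorem7p12:
  fixes n :: nat and \<delta> :: "nat \<Rightarrow> decoration"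
  assumes "n \<ge> 2"
    and "\<forall>i\<in>{1..n}. \<delta> i \<in> {Dec_I, Dec_D}"
    and "\<delta> 1 = Dec_I" and "\<delta> n = Dec_I"
  shows "\<exists>\<phi>. bij_betw \<phi> (integer_flows (Bic n \<delta>) (netflow n)) (permutrees n \<delta>)"
proof -
  have "n \<ge> 1" using assms(1) by simp
  \<comment> \<open>Flows pass to depth sequences, these to decorated trees, and these to edge
    sets.\<close>
  have "bij_betw (edges \<delta> \<circ> (build \<delta> n \<circ> code n)) (integer_flows (Bic n \<delta>) (netflow n)) (permutrees n \<delta>)"
    by (rule bij_betw_trans[OF bij_betw_trans[OF bij_betw_code[OF assms(1,2)] bij_betw_build]
          bij_betw_edges[OF \<open>n \<ge> 1\<close> assms(2)]])
  then show ?thesis by blast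
qed

end
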